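(* Let $I\subset[0,\infty)$ be an interval, let $a,b\in I$ with $a<b$, and let $f:I\to\mathbb{R}$ be differentiable on the interior $I^{\circ}$ of $I$ and at $a$ and $b$, with $f'\in L[a,b]$. Let $p>1$, $\frac1p+\frac1q=1$, let $s\in(0,1]$ be fixed, and suppose that $|f'|^q$ is $s$-convex in the second sense on $[a,b]$. Then for each $x\in[a,b]$, $$\left|f(x)-\frac{1}{b-a}\int_a^b f(u)\,du\right|\le \frac{1}{(b-a)(p+1)^{1/p}}\Big\{(b-x)^2\Big(\frac{|f'(x)|^q+|f'(b)|^q}{s+1}\Big)^{\frac1q}+(x-a)^2\Big(\frac{|f'(a)|^q+|f'(x)|^q}{s+1}\Big)^{\frac1q}\Big\}.$$
   Context: For fixed $s\in(0,1]$, a real function $g$ is $s$-convex in the second sense on $[a,b]\subset[0,\infty)$ if $g(\alpha x+(1-\alpha)y)\le \alpha^s g(x)+(1-\alpha)^s g(y)$ for all $x,y\in[a,b]$ and $\alpha\in[0,1]$. $L[a,b]$ denotes the Lebesgue integrable functions on $[a,b]$. If $a$ or $b$ is an endpoint of $I$, differentiability there is one-sided (within $I$). *)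

theory Defs
  imports "HOL-Analysis.Analysis"
begin

text \<open>
  s-convexity in the second sense.  The intended range is \<open>0 < s \<le> 1\<close> and \<open>S\<close> an interval
  contained in \<open>{0..}\<close>.  Note that \<open>0 powr s = 0\<close> and \<open>1 powr s = 1\<close>, so the conditions for
  \<open>\<alpha> = 0\<close> and \<open>\<alpha> = 1\<close> hold trivially, as they do with the usual meaning of \<open>0^s\<close>.
\<close>

definition s_convex_on :: "real \<Rightarrow> real set \<Rightarrow> (real \<Rightarrow> real) \<Rightarrow> bool" where
  "s_convex_on s S g \<longleftrightarrow>
     (\<forall>x\<in>S. \<forall>y\<in>S. \<forall>\<alpha>\<in>{0..1}.
        g (\<alpha> * x + (1 - \<alpha>) * y) \<le> \<alpha> powr s * g x + (1 - \<alpha>) powr s * g y)"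

end

theory Submission
  imports Defs
begin

text \<open>
  Substituting \<open>u = y + t (x - y)\<close> on \<open>[y, x]\<close> and integrating by parts turns the deviation of
  \<open>f x\<close> from the mean of \<open>f\<close> over that segment into \<open>(x - y) \<integral>\<^sub>0\<^sup>1 t f'(y + t (x - y)) dt\<close>.
  Hoelder's inequality, \<open>\<integral>\<^sub>0\<^sup>1 t^p dt = 1 / (p + 1)\<close> and the \<open>s\<close>-convexity bound for \<open>\<bar>f'\<bar>^q\<close> estimate
  this integral. Taking \<open>y = a\<close> and \<open>y = b\<close> and adding gives the theorem.
\<close>

lemma conjugate_exponent_gt_1:
  fixes p q :: real
  assumes "p > 1" "1 / p + 1 / q = 1"
  shows "q > 1"
proof -
  have "1 / q = 1 - 1 / p" "0 < 1 - 1 / p" "1 - 1 / p < 1"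
    using assms by auto
  then have "0 < 1 / q" "1 / q < 1" by auto
  then show ?thesis by (simp add: divide_less_eq split: if_splits)
qed

text \<open>
  The second factor is only bounded through \<open>h\<close>, so \<open>w powr q\<close> itself need not be integrable.
\<close>

lemma Hoelder_has_integral_dominated:
  fixes F v w h :: "'a::euclidean_space \<Rightarrow> real"
  assumes pq: "p > 1" "1 / p + 1 / q = 1"
    and F: "(F has_integral i) S"
    and P: "((\<lambda>t. v t powr p) has_integral P) S" "P > 0"
    and Q: "(h has_integral Q) S" "Q > 0"
    and v: "\<And>t. t \<in> S \<Longrightarrow> v t \<ge> 0"
    and w: "\<And>t. t \<in> S \<Longrightarrow> w t \<ge> 0" "\<And>t. t \<in> S \<Longrightarrow> w t powr q \<le> h t"
    and le: "\<And>t. t \<in> S \<Longrightarrow> \<bar>F t\<bar> \<le> v t * w t"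
  shows "\<bar>i\<bar> \<le> P powr (1 / p) * Q powr (1 / q)"
proof -
  have q: "q > 1" using conjugate_exponent_gt_1[OF pq] .
  \<comment> \<open>\<open>\<alpha>\<close> is the \<open>p\<close>-norm of \<open>v\<close>, and
    \<open>\<beta>\<close> plays the same role for \<open>h\<close>. Dividing by them normalises
    both factors before Young's inequality is applied.\<close>
  define \<alpha> where "\<alpha> = P powr (1 / p)"
  define \<beta> where "\<beta> = Q powr (1 / q)"
  have pos: "\<alpha> > 0" "\<beta> > 0" using P Q by (auto simp: \<alpha>_def \<beta>_def)
  have \<alpha>p: "\<alpha> powr p = P" and \<beta>q: "\<beta> powr q = Q"
    using P Q pq q by (auto simp: \<alpha>_def \<beta>_def powr_powr)
  \<comment> \<open>The pointwise majorant that Young's inequality gives for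
    \<open>v t / \<alpha>\<close> and \<open>w t / \<beta>\<close>, scaled back by
    \<open>\<alpha> * \<beta>\<close>. Its two terms contribute the shares \<open>1 / p\<close> and
    \<open>1 / q\<close>, so its integral is exactly \<open>\<alpha> * \<beta>\<close>.\<close>
  define g where "g t = (\<alpha> * \<beta>) * ((v t powr p) * (1 / (P * p)) + h t * (1 / (Q * q)))" for t
  have "(g has_integral (\<alpha> * \<beta>) * (P * (1 / (P * p)) + Q * (1 / (Q * q)))) S"
    unfolding g_def
    by (intro has_integral_mult_right has_integral_add has_integral_mult_left P Q)
  moreover have "P * (1 / (P * p)) + Q * (1 / (Q * q)) = 1" using P Q pq by simp
  ultimately have g: "(g has_integral \<alpha> * \<beta>) S" by simp
  have "\<bar>F t\<bar> \<le> g t" if t: "t \<in> S" for t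
  proof -
    have "\<bar>F t\<bar> \<le> (\<alpha> * \<beta>) * ((v t / \<alpha>) * (w t / \<beta>))"
      using le[OF t] pos by simp
    also have "(v t / \<alpha>) * (w t / \<beta>) \<le> (v t / \<alpha>) powr p / p + (w t / \<beta>) powr q / q"
      using v[OF t] w(1)[OF t] pos by (intro Youngs_inequality[OF pq(1) q pq(2)]) auto
    also have "\<dots> = v t powr p / (P * p) + w t powr q / (Q * q)"
      using v[OF t] w(1)[OF t] pos by (simp add: powr_divide \<alpha>p \<beta>q)
    also have "\<dots> \<le> v t powr p / (P * p) + h t / (Q * q)"
      using w(2)[OF t] Q q by (simp add: divide_right_mono)
    finally show ?thesis using pos by (simp add: g_def mult_left_mono)
  qed
  then have "\<bar>integral S F\<bar> \<le> integral S g"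
    using integral_norm_bound_integral[of F S g] F g by (auto simp: integrable_on_def)
  then show ?thesis
    using F g by (simp add: integral_unique \<alpha>_def \<beta>_def)
qed

text \<open>The normalised case, where the segment is the unit interval and \<open>A\<close>,
  \<open>B\<close> stand for the values of the \<open>s\<close>-convex function at \<open>1\<close>
  and \<open>0\<close>. Both weights \<open>t powr s\<close> and \<open>(1 - t) powr s\<close> have
  integral \<open>1 / (s + 1)\<close>, hence the symmetric mean
  \<open>(A + B) / (s + 1)\<close>.\<close>

lemma unit_interval_mean_deviation:
  fixes \<phi> \<psi> :: "real \<Rightarrow> real"
  assumes pq: "p > 1" "1 / p + 1 / q = 1" and s: "0 < s"
    and deriv: "\<And>t. t \<in> {0..1} \<Longrightarrow> (\<phi> has_real_derivative \<psi> t) (at t within {0..1})"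
    and bound: "\<And>t. t \<in> {0..1} \<Longrightarrow> \<bar>\<psi> t\<bar> powr q \<le> t powr s * A + (1 - t) powr s * B"
    and mean: "(\<phi> has_integral i) {0..1}"
  shows "\<bar>\<phi> 1 - i\<bar> \<le> 1 / (p + 1) powr (1 / p) * ((A + B) / (s + 1)) powr (1 / q)"
proof -
  \<comment> \<open>Since \<open>0 powr s = 0\<close> and \<open>1 powr s = 1\<close>, the bound at
    \<open>t = 1\<close> and \<open>t = 0\<close> compares these values with \<open>A\<close> and
    \<open>B\<close> alone.\<close>
  have "0 \<le> \<bar>\<psi> 1\<bar> powr q" "0 \<le> \<bar>\<psi> 0\<bar> powr q" by auto
  then have AB: "A \<ge> 0" "B \<ge> 0" using bound[of 1] bound[of 0] s
    by (auto simp del: powr_ge_zero intro: order_trans)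
  \<comment> \<open>Integration by parts, with \<open>t * \<phi> t\<close> as antiderivative. The
    factor \<open>t\<close> removes the boundary term at \<open>0\<close>, and integrability of
    \<open>t * \<psi> t\<close> comes out by subtracting \<open>mean\<close>.\<close>
  have "((\<lambda>t. t * \<psi> t + \<phi> t) has_integral (1 * \<phi> 1 - 0 * \<phi> 0)) {0..1}"
    by (rule fundamental_theorem_of_calculus)
       (auto intro!: derivative_eq_intros deriv
             simp flip: has_real_derivative_iff_has_vector_derivative)
  from has_integral_diff[OF this mean]
  have F: "((\<lambda>t. t * \<psi> t) has_integral (\<phi> 1 - i)) {0..1}" by simp
  have P: "((\<lambda>t. t powr p) has_integral 1 / (p + 1)) {0..1}" and
    s1: "((\<lambda>t. t powr s) has_integral 1 / (s + 1)) {0..1}"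
    using has_integral_powr_from_0[of p 1] has_integral_powr_from_0[of s 1] pq s by auto
  \<comment> \<open>The reflection \<open>t \<mapsto> 1 - t\<close> reduces this to
    \<open>s1\<close>.\<close>
  have s2: "((\<lambda>t. (1 - t) powr s) has_integral 1 / (s + 1)) {0..1}"
    using has_integral_affinity[of "\<lambda>t. t powr s" "1 / (s + 1)" 0 1 "-1" 1] s1
      image_affinity_atLeastAtMost[of "-1" 1 0 "1::real"]
    by simp
  have Q: "((\<lambda>t. t powr s * A + (1 - t) powr s * B) has_integral (A + B) / (s + 1)) {0..1}"
    using has_integral_add[OF has_integral_mult_left[OF s1, of A] has_integral_mult_left[OF s2, of B]]
    by (simp add: add_divide_distrib)
  show ?thesis
  \<comment> \<open>Hoelder in the form above needs a positive \<open>Q\<close>. In the degenerate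
    case the bound forces \<open>\<psi>\<close> to vanish on the unit interval.\<close>
  proof (cases "A + B = 0")
    case True
    then have "A = 0" "B = 0" using AB by auto
    then have "t * \<psi> t = 0" if "t \<in> {0..1}" for t
      using bound[OF that] by simp
    then have "((\<lambda>t. t * \<psi> t) has_integral 0) {0..1}"
      by (rule has_integral_is_0)
    then have "\<phi> 1 - i = 0"
      using F has_integral_unique by blast
    then show ?thesis using pq(1) by simp
  next
    case False
    then have "(A + B) / (s + 1) > 0" using AB s by auto
    then have "\<bar>\<phi> 1 - i\<bar> \<le> (1 / (p + 1)) powr (1 / p) * ((A + B) / (s + 1)) powr (1 / q)"
      using pq(1)
      by (intro Hoelder_has_integral_dominated[OF pq F P _ Q, of "\<lambda>t. \<bar>\<psi> t\<bar>"])
         (auto simp: abs_mult bound)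
    then show ?thesis using pq(1) by (simp add: powr_divide)
  qed
qed

text \<open>Stated for an unoriented segment, so that one lemma serves both a left endpoint
  \<open>y < x\<close> and a right endpoint \<open>y > x\<close>. One factor
  \<open>\<bar>x - y\<bar>\<close> comes from the length of the segment, the other from the chain
  rule.\<close>

lemma segment_mean_deviation:
  fixes f f' :: "real \<Rightarrow> real"
  assumes pq: "p > 1" "1 / p + 1 / q = 1" and s: "0 < s"
    and deriv: "\<And>u. u \<in> closed_segment y x \<Longrightarrow>
      (f has_real_derivative f' u) (at u within closed_segment y x)"
    and conv: "s_convex_on s (closed_segment y x) (\<lambda>u. \<bar>f' u\<bar> powr q)"
  shows "\<bar>\<bar>x - y\<bar> * f x - integral (closed_segment y x) f\<bar>
    \<le> (x - y)\<^sup>2 * (1 / (p + 1) powr (1 / p)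
        * ((\<bar>f' x\<bar> powr q + \<bar>f' y\<bar> powr q) / (s + 1)) powr (1 / q))"
proof (cases "x = y")
  case True
  then show ?thesis by simp
next
  case False
  \<comment> \<open>\<open>m\<close> is signed: the change of variables in the integral produces
    \<open>\<bar>m\<bar>\<close>, the chain rule produces \<open>m\<close>.\<close>
  define m where "m = x - y"
  have m: "m \<noteq> 0" using False by (simp add: m_def)
  define J where "J = integral (closed_segment y x) f"
  define C where "C = 1 / (p + 1) powr (1 / p)
    * ((\<bar>f' x\<bar> powr q + \<bar>f' y\<bar> powr q) / (s + 1)) powr (1 / q)"
  have img: "(\<lambda>t. m * t + y) ` {0..1} = closed_segment y x"
    by (auto simp: image_affinity_atLeastAtMost closed_segment_eq_real_ivl m_def)
  have inv: "(\<lambda>u. (1 / m) * u + - ((1 / m) * y)) ` closed_segment y x = {0..1}"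
    using m unfolding img[symmetric] image_image by (simp add: field_simps)
  have "continuous_on (closed_segment y x) f"
    using deriv by (meson DERIV_continuous continuous_on_eq_continuous_within)
  then have "f integrable_on closed_segment y x"
    by (auto simp: closed_segment_eq_real_ivl intro: integrable_continuous_interval)
  then have "(f has_integral J) (closed_segment y x)"
    by (simp add: J_def integrable_integral)
  moreover obtain c d where cd: "closed_segment y x = cbox c d"
    unfolding closed_segment_eq_real_ivl by (metis box_real(2))
  ultimately have "((\<lambda>t. f (m * t + y)) has_integral J / \<bar>m\<bar>) {0..1}"
    using has_integral_affinity[of f J c d m y] m inv by simp
  \<comment> \<open>Dividing by \<open>m\<close> cancels the chain rule factor, so the derivative
    becomes \<open>f' (m * t + y)\<close>, to which \<open>conv\<close> applies directly.\<close>
  from has_integral_mult_left[OF this, of "1 / m"]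
  have mean: "((\<lambda>t. f (m * t + y) / m) has_integral J / \<bar>m\<bar> / m) {0..1}" by simp
  have "\<bar>f (m * 1 + y) / m - J / \<bar>m\<bar> / m\<bar> \<le> C"
    unfolding C_def
  proof (rule unit_interval_mean_deviation[OF pq s _ _ mean])
    fix t :: real assume t: "t \<in> {0..1}"
    have "(f has_real_derivative f' (m * t + y)) (at (m * t + y) within (\<lambda>t. m * t + y) ` {0..1})"
      unfolding img by (rule deriv) (use t img in blast)
    moreover have "((\<lambda>t. m * t + y) has_real_derivative m) (at t within {0..1})"
      by (auto intro!: derivative_eq_intros)
    ultimately have "((\<lambda>t. f (m * t + y)) has_real_derivative f' (m * t + y) * m) (at t within {0..1})"
      using DERIV_image_chain by (fastforce simp: o_def)
    from DERIV_cdivide[OF this, of m]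
    show "((\<lambda>t. f (m * t + y) / m) has_real_derivative f' (m * t + y)) (at t within {0..1})"
      using m by simp
    have "m * t + y = t * x + (1 - t) * y" by (simp add: m_def algebra_simps)
    then show "\<bar>f' (m * t + y)\<bar> powr q \<le> t powr s * \<bar>f' x\<bar> powr q + (1 - t) powr s * \<bar>f' y\<bar> powr q"
      using conv t by (simp add: s_convex_on_def)
  qed
  \<comment> \<open>Multiplying by \<open>\<bar>m\<bar>\<close> twice undoes the division by
    \<open>m\<close> and the averaging over the segment.\<close>
  then have "\<bar>m\<bar> * \<bar>m\<bar> * \<bar>f x / m - J / \<bar>m\<bar> / m\<bar> \<le> \<bar>m\<bar> * \<bar>m\<bar> * C"
    by (intro mult_left_mono) (auto simp: m_def)
  moreover have "\<bar>m\<bar> * \<bar>m\<bar> * \<bar>f x / m - J / \<bar>m\<bar> / m\<bar> = \<bar>\<bar>m\<bar> * f x - J\<bar>"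
  proof -
    have "f x / m - J / \<bar>m\<bar> / m = (\<bar>m\<bar> * f x - J) / (\<bar>m\<bar> * m)"
      using m by (simp add: field_simps)
    then show ?thesis using m by (simp add: abs_mult)
  qed
  ultimately show ?thesis
    by (simp add: J_def C_def m_def power2_eq_square flip: abs_mult)
qed

theorem theorem9:
  fixes I :: "real set" and a b p q s x :: real and f f' :: "real \<Rightarrow> real"
  assumes "is_interval I" and "I \<subseteq> {0..}"
    and "a \<in> I" and "b \<in> I" and "a < b"
    and "\<And>u. u \<in> interior I \<union> {a, b} \<Longrightarrow> (f has_real_derivative f' u) (at u within I)"
    and "f' absolutely_integrable_on {a..b}"
    and "p > 1" and "1 / p + 1 / q = 1"
    and "0 < s" and "s \<le> 1"
    and "s_convex_on s {a..b} (\<lambda>u. \<bar>f' u\<bar> powr q)"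
    and "x \<in> {a..b}"
  shows "\<bar>f x - 1 / (b - a) * integral {a..b} f\<bar>
    \<le> 1 / ((b - a) * (p + 1) powr (1 / p)) *
      ((b - x)\<^sup>2 * ((\<bar>f' x\<bar> powr q + \<bar>f' b\<bar> powr q) / (s + 1)) powr (1 / q)
       + (x - a)\<^sup>2 * ((\<bar>f' a\<bar> powr q + \<bar>f' x\<bar> powr q) / (s + 1)) powr (1 / q))"
proof -
  have sub: "{a..b} \<subseteq> I"
    using mem_is_interval_1_I[OF assms(1,3,4)] by auto
  have int: "{a<..<b} \<subseteq> interior I"
    using sub by (intro interior_maximal) auto
  \<comment> \<open>Every point of \<open>{a..b}\<close> is \<open>a\<close>, \<open>b\<close> or
    interior to \<open>I\<close>, and a derivative within \<open>I\<close> is one within any smaller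
    set. This gives the one-sided derivatives on the two subsegments.\<close>
  have deriv: "(f has_real_derivative f' u) (at u within T)" if "u \<in> T" "T \<subseteq> {a..b}" for u T
  proof (rule DERIV_subset)
    show "(f has_real_derivative f' u) (at u within I)"
      using that int by (intro assms(6)) force
  qed (use that sub in auto)
  have conv: "s_convex_on s T (\<lambda>u. \<bar>f' u\<bar> powr q)" if "T \<subseteq> {a..b}" for T
    using assms(12) that unfolding s_convex_on_def by blast
  have "continuous_on {a..b} f"
    using deriv by (meson DERIV_continuous continuous_on_eq_continuous_within order_refl)
  then have "f integrable_on {a..b}"
    by (rule integrable_continuous_interval)
  then have comb: "integral {a..x} f + integral {x..b} f = integral {a..b} f"
    using assms(13) by (intro Henstock_Kurzweil_Integration.integral_combine) auto
  have segs: "closed_segment a x = {a..x}" "closed_segment b x = {x..b}"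
    using assms(13) by (auto simp: closed_segment_eq_real_ivl)
  have dev: "\<bar>\<bar>x - y\<bar> * f x - integral (closed_segment y x) f\<bar>
    \<le> (x - y)\<^sup>2 * (1 / (p + 1) powr (1 / p)
        * ((\<bar>f' x\<bar> powr q + \<bar>f' y\<bar> powr q) / (s + 1)) powr (1 / q))"
    if "closed_segment y x \<subseteq> {a..b}" for y
    by (rule segment_mean_deviation[OF assms(8,9,10)]) (use that deriv conv in auto)
  define K where "K = 1 / (p + 1) powr (1 / p)"
  define X where "X = ((\<bar>f' x\<bar> powr q + \<bar>f' b\<bar> powr q) / (s + 1)) powr (1 / q)"
  define Y where "Y = ((\<bar>f' a\<bar> powr q + \<bar>f' x\<bar> powr q) / (s + 1)) powr (1 / q)"
  have "\<bar>(x - a) * f x - integral {a..x} f\<bar> \<le> (x - a)\<^sup>2 * (K * Y)"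
    using dev[of a] assms(13) segs by (simp add: K_def Y_def add.commute)
  moreover have "\<bar>(b - x) * f x - integral {x..b} f\<bar> \<le> (b - x)\<^sup>2 * (K * X)"
    using dev[of b] assms(13) segs by (simp add: K_def X_def power2_commute)
  \<comment> \<open>The lengths \<open>x - a\<close> and \<open>b - x\<close> add up to
    \<open>b - a\<close>, so the unnormalised deviations of the two segments add up to that of the
    whole interval.\<close>
  moreover have "(b - a) * f x - integral {a..b} f =
    ((x - a) * f x - integral {a..x} f) + ((b - x) * f x - integral {x..b} f)"
    using comb by (simp add: algebra_simps)
  ultimately have main: "\<bar>(b - a) * f x - integral {a..b} f\<bar> \<le> K * ((b - x)\<^sup>2 * X + (x - a)\<^sup>2 * Y)"
    by (simp add: algebra_simps)
  have "f x - 1 / (b - a) * integral {a..b} f = ((b - a) * f x - integral {a..b} f) / (b - a)"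
    using assms(5) by (simp add: field_simps)
  then have "\<bar>f x - 1 / (b - a) * integral {a..b} f\<bar> = \<bar>(b - a) * f x - integral {a..b} f\<bar> / (b - a)"
    using assms(5) by simp
  also have "\<dots> \<le> K * ((b - x)\<^sup>2 * X + (x - a)\<^sup>2 * Y) / (b - a)"
    using main assms(5) by (simp add: divide_right_mono)
  finally show ?thesis
    by (simp add: K_def X_def Y_def mult.commute)
qed

end
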